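(* Let $\mu\in\mathbb C$ with $0<\Re\mu\le 1/2$, and define the complex sequence $\{x_n\}_{n\ge 0}$ by $$x_n=x_n(\mu)=\sum_{k=0}^n\binom{n}{k}(-1)^k\,\frac{\Gamma(k+\mu)\,\Gamma(k+1-\mu)}{\Gamma(k+1)^2},\qquad n\ge 0.$$ Then $$H\{x_n\}=\left\{\frac{\pi}{\sin(\pi\mu)}\,x_n\right\},$$ and $\{x_n\}\notin\ell^2$.
   Context: $H=\left(\frac{1}{i+j+1}\right)_{i,j\ge 0}$ is the (infinite) Hilbert matrix, acting on a complex sequence $x=\{x_n\}_{n\ge 0}$ by $(Hx)_i=\sum_{j=0}^\infty\frac{x_j}{i+j+1}$, $i\ge0$, whenever these series converge. $\Gamma$ is the Gamma function and $\ell^2$ is the space of square-summable complex sequences indexed by $n\ge0$. *)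

theory Defs
  imports "HOL-Analysis.Analysis"
begin

definition hilbert_matrix :: "nat \<Rightarrow> nat \<Rightarrow> complex" where
  "hilbert_matrix i j = 1 / of_nat (i + j + 1)"

(* Sequences on which the matrix acts.  Convergence is that of the partial sums, not necessarily
   absolute.  Off this domain "hilbert_apply" carries no information, because suminf is then
   an arbitrary value. *)
definition hilbert_domain :: "(nat \<Rightarrow> complex) set" where
  "hilbert_domain = {x. \<forall>i. summable (\<lambda>j. hilbert_matrix i j * x j)}"

definition hilbert_apply :: "(nat \<Rightarrow> complex) \<Rightarrow> nat \<Rightarrow> complex" where
  "hilbert_apply x i = (\<Sum>j. hilbert_matrix i j * x j)"

definition ell2 :: "(nat \<Rightarrow> complex) set" where
  "ell2 = {x. summable (\<lambda>n. (norm (x n))\<^sup>2)}"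

definition hilbert_seq :: "complex \<Rightarrow> nat \<Rightarrow> complex" where
  "hilbert_seq \<mu> n =
     (\<Sum>k=0..n. of_nat (n choose k) * (- 1) ^ k *
        (Gamma (of_nat k + \<mu>) * Gamma (of_nat k + 1 - \<mu>) / (Gamma (of_nat k + 1))\<^sup>2))"

end

theory Submission
  imports Defs
begin

text \<open>
  The Hilbert matrix commutes with the difference operator
  $(Jx)_n = (n+1)^2 (x_{n+1} - x_n) - n^2 (x_n - x_{n-1})$: the kernel $1/(i+n+1)$ has the same
  image under $J$ acting in $n$ as under $J$ acting in $i$ (\<open>jacobi_hilbert_matrix_commute\<close>).
  Applying $J$ to the binomial sum term by term gives $Jx = -\mu(1-\mu)\,x$
  (\<open>hilbert_seq_eigen\<close>).  Since $n^2$ vanishes at $n = 0$, an eigenvector of $J$ is determined by its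
  entry at $0$ (\<open>jacobi_eigen_unique\<close>).  So $Hx$, being again an eigenvector of $J$ for the same
  eigenvalue, is a multiple of $x$.

  Moving $J$ from $x$ to the kernel requires decay of $x$.  To leading order, solutions are
  combinations of $n^{-\mu}$ and $n^{\mu-1}$ (of $n^{-1/2}$ and $n^{-1/2}\log n$ when $\mu = 1/2$).
  The first-order expression $L_n = n(x_n - x_{n-1}) + \mu x_n$ removes the first of these to leading order and satisfies a recurrence driven only by $\mu^3 x_n$
  (\<open>ladder_Suc\<close>).  A suitable combination of $|L_n|$ and $|x_n|$ therefore contracts by a factor
  $1 - \delta/n$ at each large step, whence $\sum |x_n|/(n+1) < \infty$, $x_n \to 0$ and
  $n(x_n - x_{n-1}) \to 0$ (\<open>jacobi_eigen_decay\<close>).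

  To find the factor, $(Hx)_0$ is embedded in the moments
  $Z_m = \sum_n \frac{n!\,m!}{(n+m+1)!}\,x_n$, with $Z_0 = (Hx)_0$.  Summation by parts shows that they
  obey the two-term recurrence of the coefficients
  $c_m = \Gamma(m+\mu)\Gamma(m+1-\mu)/\Gamma(m+1)^2$, so $Z_m/c_m$ is constant.  As $(m+1) Z_m \to x_0$
  and $(m+1) c_m \to 1$, the constant is $x_0$, and $Z_0 = c_0 x_0 = \frac{\pi}{\sin \pi\mu}\,x_0$ by the
  reflection formula.

  If $x$ were square-summable, so would be $n(x_n - x_{n-1})$, by an energy estimate
  (\<open>ell2_gradient\<close>).  This is contradicted in the two cases with $\Im\mu \neq 0$, and square-summability
  is excluded directly for real $\mu$.  When $\mu(1-\mu)$ is not real, the imaginary part of the energy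
  identity keeps $n^2\,|x_n|\,|x_{n+1} - x_n|$ away from $0$.  When $\mu$ is real, $L_n \ge 0$ (after
  scaling to $x_0 = 1$) and hence $x_n$ decays no faster than $n^{-1/2}$.  When $\mu$ is not
  real and $\Re\mu = 1/2$, the sum
  of $|L_n|$ for $\mu$ and for $1-\mu$ decays no faster than $n^{-1/2}$.
\<close>

text \<open>
  With truncated subtraction the term for $n = 0$ is $0$, in accordance with the
  weight $n^2$ in front of an entry at $-1$.
\<close>

definition flux :: "(nat \<Rightarrow> complex) \<Rightarrow> nat \<Rightarrow> complex" where
  "flux x n = (of_nat n)\<^sup>2 * (x n - x (n - 1))"

definition jacobi :: "(nat \<Rightarrow> complex) \<Rightarrow> nat \<Rightarrow> complex" where
  "jacobi x n = flux x (Suc n) - flux x n"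

text \<open>
  The eigenvalue is written in terms of $\mu$ because it does not distinguish $\mu$ from $1-\mu$, while
  the factorization through \<open>ladder\<close> depends on which of the two is chosen.
\<close>

definition jacobi_eigen :: "complex \<Rightarrow> (nat \<Rightarrow> complex) \<Rightarrow> bool" where
  "jacobi_eigen \<mu> x \<longleftrightarrow> (\<forall>n. jacobi x n = - (\<mu> * (1 - \<mu>)) * x n)"

text \<open>
  $n(x_n - x_{n-1})$ is a discrete $t\,x'(t)$, so this annihilates $n^{-\mu}$ up to lower order; on
  the other characteristic power $n^{\mu-1}$ it has leading factor $2\mu-1$.
\<close>

definition ladder :: "complex \<Rightarrow> (nat \<Rightarrow> complex) \<Rightarrow> nat \<Rightarrow> complex" where
  "ladder \<mu> x n = of_nat n * (x n - x (n - 1)) + \<mu> * x n"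

definition gamma_coeff :: "complex \<Rightarrow> nat \<Rightarrow> complex" where
  "gamma_coeff \<mu> k =
     Gamma (of_nat k + \<mu>) * Gamma (of_nat k + 1 - \<mu>) / (Gamma (of_nat k + 1))\<^sup>2"

section \<open>The second-order recurrence of the binomial sums\<close>

lemma not_nonpos_Int_if_Re_pos: "0 < Re z \<Longrightarrow> z \<notin> \<int>\<^sub>\<le>\<^sub>0"
  by (auto elim!: nonpos_Ints_cases)

lemma gamma_coeff_Suc:
  assumes "0 < Re \<mu>" "Re \<mu> < 1"
  shows "(of_nat (Suc k))\<^sup>2 * gamma_coeff \<mu> (Suc k)
         = (of_nat k * of_nat (Suc k) + \<mu> * (1 - \<mu>)) * gamma_coeff \<mu> k"
proof -
  have g: "Gamma (z + 1) = z * Gamma z" if "0 < Re z" for z :: complex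
    using that not_nonpos_Int_if_Re_pos by (metis Gamma_plus1)
  have 1: "Gamma (of_nat (Suc k) + \<mu>) = (of_nat k + \<mu>) * Gamma (of_nat k + \<mu>)"
    using g[of "of_nat k + \<mu>"] assms by (simp add: add_ac)
  have 2: "Gamma (of_nat (Suc k) + 1 - \<mu>) = (of_nat k + 1 - \<mu>) * Gamma (of_nat k + 1 - \<mu>)"
    using g[of "of_nat k + 1 - \<mu>"] assms by (simp add: algebra_simps)
  have 3: "Gamma (of_nat (Suc k) + 1) = of_nat (Suc k) * Gamma (of_nat k + 1 :: complex)"
    using g[of "of_nat k + 1"] by (simp add: add_ac)
  have nz: "Gamma (of_nat k + 1 :: complex) \<noteq> 0"
    by (simp add: Gamma_eq_zero_iff not_nonpos_Int_if_Re_pos)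
  have ne: "(of_nat (Suc k) :: complex) \<noteq> 0" by (simp only: of_nat_eq_0_iff)
  have "(of_nat (Suc k))\<^sup>2 * gamma_coeff \<mu> (Suc k) =
        (of_nat k + \<mu>) * (of_nat k + 1 - \<mu>) * gamma_coeff \<mu> k"
    unfolding gamma_coeff_def 1 2 3 using nz ne
    by (simp add: power_mult_distrib del: of_nat_Suc)
  also have "(of_nat k + \<mu>) * (of_nat k + 1 - \<mu>) = of_nat k * of_nat (Suc k) + \<mu> * (1 - \<mu>)"
    by (simp add: algebra_simps)
  finally show ?thesis .
qed

lemma flux_binomial:
  "flux (\<lambda>n. of_nat (n choose k)) (Suc n) = of_nat (Suc n) * of_nat k * of_nat (Suc n choose k)"
proof (cases k)
  case (Suc l)
  have "Suc n * (n choose l) = Suc l * (Suc n choose Suc l)"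
    using Suc_times_binomial_eq[of n l] by (simp del: binomial_Suc_Suc)
  hence "of_nat (Suc n) * of_nat (n choose l) = (of_nat (Suc l) * of_nat (Suc n choose Suc l) :: complex)"
    by (metis of_nat_mult)
  moreover have "of_nat (Suc n choose Suc l) - of_nat (n choose Suc l) = (of_nat (n choose l) :: complex)"
    by simp
  ultimately show ?thesis
    unfolding flux_def Suc by (simp add: power2_eq_square mult.assoc del: of_nat_Suc binomial_Suc_Suc)
qed (simp add: flux_def)

text \<open>
  By Pascal's rule the right-hand side is $k(k+1)\binom nk + k^2\binom n{k-1}$.  So $J$ is bidiagonal on
  binomial coefficients, and eigenvectors of $J$ are found from a two-term recurrence in $k$.
\<close>

lemma jacobi_binomial:
  "jacobi (\<lambda>n. of_nat (n choose k)) n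
   = (of_nat k)\<^sup>2 * of_nat (Suc n choose k) + of_nat k * of_nat (n choose k)"
proof -
  have f: "flux (\<lambda>n. of_nat (n choose k)) n = of_nat n * of_nat k * of_nat (n choose k)"
  proof (cases n)
    case 0 thus ?thesis by (simp add: flux_def)
  next
    case (Suc m) thus ?thesis using flux_binomial[of k m] by simp
  qed
  have "of_nat (Suc n) * (of_nat (Suc n choose k) - of_nat (n choose k))
        = (of_nat k * of_nat (Suc n choose k) :: complex)"
    using flux_binomial[of k n] unfolding flux_def
    by (simp add: power2_eq_square mult.assoc del: of_nat_Suc binomial_Suc_Suc)
  thus ?thesis
    unfolding jacobi_def f flux_binomial power2_eq_square
    by (simp add: right_diff_distrib mult_ac del: binomial_Suc_Suc of_nat_Suc) (simp add: algebra_simps)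
qed

lemma jacobi_sum_scaled:
  "jacobi (\<lambda>n. \<Sum>k\<in>A. c k * f k n) n = (\<Sum>k\<in>A. c k * jacobi (f k) n)"
  by (induction A rule: infinite_finite_induct) (simp_all add: jacobi_def flux_def algebra_simps)

lemma jacobi_local:
  assumes "x (Suc n) = y (Suc n)" "x n = y n" "x (n - 1) = y (n - 1)"
  shows "jacobi x n = jacobi y n"
  using assms by (simp add: jacobi_def flux_def)

text \<open>
  The bidiagonal action of $J$ on $\binom nk$ meets the recurrence \<open>gamma_coeff_Suc\<close>: after shifting the
  index in the $k^2$ part, the coefficient $k(k+1)$ cancels and only $-\mu(1-\mu)$ is left.
\<close>

lemma hilbert_seq_eigen:
  assumes "0 < Re \<mu>" "Re \<mu> < 1"
  shows "jacobi_eigen \<mu> (hilbert_seq \<mu>)"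
  unfolding jacobi_eigen_def
proof
  fix n
  let ?c = "\<lambda>k. (-1) ^ k * gamma_coeff \<mu> k"
  \<comment> \<open>One summation range serves the three indices \<open>n - 1\<close>, \<open>n\<close> and \<open>n + 1\<close> that \<open>jacobi\<close> reads.\<close>
  have expand: "hilbert_seq \<mu> m = (\<Sum>k\<le>Suc n. ?c k * of_nat (m choose k))" if "m \<le> Suc n" for m
  proof -
    have "hilbert_seq \<mu> m = (\<Sum>k\<le>m. ?c k * of_nat (m choose k))"
      by (simp add: hilbert_seq_def gamma_coeff_def atLeast0AtMost mult_ac)
    also have "\<dots> = (\<Sum>k\<le>Suc n. ?c k * of_nat (m choose k))"
      using that by (intro sum.mono_neutral_left) auto
    finally show ?thesis .
  qed
  have "jacobi (hilbert_seq \<mu>) n = jacobi (\<lambda>m. \<Sum>k\<le>Suc n. ?c k * of_nat (m choose k)) n"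
    by (intro jacobi_local expand) auto
  also have "\<dots> = (\<Sum>k\<le>Suc n. ?c k * ((of_nat k)\<^sup>2 * of_nat (Suc n choose k) + of_nat k * of_nat (n choose k)))"
    by (simp only: jacobi_sum_scaled jacobi_binomial)
  also have "\<dots> = (\<Sum>k\<le>Suc n. ?c k * (of_nat k)\<^sup>2 * (of_nat (Suc n choose k) - of_nat (n choose k)))
                 + (\<Sum>k\<le>Suc n. ?c k * (of_nat k * of_nat (Suc k)) * of_nat (n choose k))"
    unfolding sum.distrib[symmetric] by (intro sum.cong refl) (simp add: algebra_simps power2_eq_square)
  also have "(\<Sum>k\<le>Suc n. ?c k * (of_nat k)\<^sup>2 * (of_nat (Suc n choose k) - of_nat (n choose k)))
      = (\<Sum>k\<le>n. ?c (Suc k) * (of_nat (Suc k))\<^sup>2 * of_nat (n choose k))"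
    unfolding sum.atMost_Suc_shift by simp
  also have "\<dots> = (\<Sum>k\<le>Suc n. ?c (Suc k) * (of_nat (Suc k))\<^sup>2 * of_nat (n choose k))"
    by simp
  also have "\<dots> = (\<Sum>k\<le>Suc n. - ?c k * (of_nat k * of_nat (Suc k) + \<mu> * (1 - \<mu>)) * of_nat (n choose k))"
  proof (intro sum.cong refl)
    fix k
    have "?c (Suc k) * (of_nat (Suc k))\<^sup>2
          = - ((-1) ^ k * ((of_nat (Suc k))\<^sup>2 * gamma_coeff \<mu> (Suc k)))" by simp
    also have "\<dots> = - ?c k * (of_nat k * of_nat (Suc k) + \<mu> * (1 - \<mu>))"
      unfolding gamma_coeff_Suc[OF assms] by simp
    finally show "?c (Suc k) * (of_nat (Suc k))\<^sup>2 * of_nat (n choose k)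
        = - ?c k * (of_nat k * of_nat (Suc k) + \<mu> * (1 - \<mu>)) * of_nat (n choose k)" by simp
  qed
  also have "\<dots> + (\<Sum>k\<le>Suc n. ?c k * (of_nat k * of_nat (Suc k)) * of_nat (n choose k))
      = - (\<mu> * (1 - \<mu>)) * (\<Sum>k\<le>Suc n. ?c k * of_nat (n choose k))"
    unfolding sum.distrib[symmetric] sum_distrib_left
    by (intro sum.cong refl) (simp add: algebra_simps)
  also have "(\<Sum>k\<le>Suc n. ?c k * of_nat (n choose k)) = hilbert_seq \<mu> n"
    using expand[of n] by simp
  finally show "jacobi (hilbert_seq \<mu>) n = - (\<mu> * (1 - \<mu>)) * hilbert_seq \<mu> n" .
qed

text \<open>
  The recurrence has second order, but at $n = 0$ it reads $x_1 - x_0 = -\mu(1-\mu)x_0$, so only $x_0$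
  is free.
\<close>

lemma jacobi_eigen_unique:
  assumes "jacobi_eigen \<mu> x" "jacobi_eigen \<mu> y"
  shows "x 0 * y n = y 0 * x n"
proof -
  have "x 0 * y n = y 0 * x n \<and> x 0 * y (n - 1) = y 0 * x (n - 1)"
  proof (induction n)
    case (Suc n)
    have step: "flux z (Suc n) = flux z n - \<mu> * (1 - \<mu>) * z n" if "jacobi_eigen \<mu> z" for z
      using that unfolding jacobi_eigen_def jacobi_def
      by (metis diff_add_cancel minus_mult_left uminus_add_conv_diff)
    have "c * flux z n = (of_nat n)\<^sup>2 * (c * z n - c * z (n - 1))" for c z
      by (simp add: flux_def algebra_simps)
    hence "x 0 * flux y n = y 0 * flux x n" using Suc by simp
    hence "x 0 * flux y (Suc n) = y 0 * flux x (Suc n)"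
      using Suc unfolding step[OF assms(1)] step[OF assms(2)] by (simp add: algebra_simps)
    hence "(of_nat (Suc n))\<^sup>2 * (x 0 * (y (Suc n) - y n)) = (of_nat (Suc n))\<^sup>2 * (y 0 * (x (Suc n) - x n))"
      unfolding flux_def by (simp add: algebra_simps del: of_nat_Suc)
    hence "x 0 * (y (Suc n) - y n) = y 0 * (x (Suc n) - x n)"
      by (simp del: of_nat_Suc)
    thus ?case using Suc by (simp add: algebra_simps)
  qed (simp add: mult.commute)
  thus ?thesis ..
qed

section \<open>Decay of solutions of the recurrence\<close>

lemma ladder_factor: "(of_nat n + \<mu>) * x n = of_nat n * x (n - 1) + ladder \<mu> x n"
  by (simp add: ladder_def algebra_simps)

text \<open>
  Together with \<open>ladder_factor\<close> this splits the second-order recurrence into two first-order ones, up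
  to the term $\mu^3 x_n$.  The factor $n(n+1+\mu)/(n+1)^2$ is about $1 - (1-\mu)/n$, which gives the decay
  rate of $L$, and $x_n$ enters with a factor of order $n^{-2}$ only.
\<close>

lemma ladder_Suc:
  assumes "jacobi_eigen \<mu> x"
  shows "(of_nat (Suc n))\<^sup>2 * ladder \<mu> x (Suc n)
         = of_nat n * (of_nat (Suc n) + \<mu>) * ladder \<mu> x n + \<mu> ^ 3 * x n"
proof -
  have "(of_nat (Suc n))\<^sup>2 * ladder \<mu> x (Suc n)
        - (of_nat n * (of_nat (Suc n) + \<mu>) * ladder \<mu> x n + \<mu> ^ 3 * x n)
        = (of_nat (Suc n) + \<mu>) * (jacobi x n + \<mu> * (1 - \<mu>) * x n)"
    unfolding ladder_def jacobi_def flux_def by (simp add: algebra_simps power2_eq_square power3_eq_cube)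
  also have "\<dots> = 0" using assms by (simp add: jacobi_eigen_def)
  finally show ?thesis by simp
qed

lemma not_summable_if_ge_harmonic:
  fixes f :: "nat \<Rightarrow> real"
  assumes "c > 0" "eventually (\<lambda>n. c / real (Suc n) \<le> f n) sequentially"
  shows "\<not> summable f"
proof
  assume "summable f"
  hence "summable (\<lambda>n. c / real (Suc n))"
    by (rule summable_comparison_test_ev[rotated])
       (use assms in \<open>auto elim!: eventually_mono\<close>)
  hence "summable (\<lambda>n. (1 / c) * (c / real (Suc n)))" by (rule summable_mult)
  hence "summable (\<lambda>n. inverse (real (Suc n)))" using assms(1) by (simp add: field_simps)
  thus False using not_summable_harmonic[where 'a = real]
    by (subst (asm) summable_Suc_iff) (simp add: inverse_eq_divide)
qed

text \<open>
  The hypothesis makes $\delta M_n/(n+1)$ at most the telescoping difference $M_n - M_{n+1}$.  A positive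
  limit of $M$ would contradict the resulting convergence, because the harmonic series diverges.
\<close>

lemma log_decay:
  fixes M :: "nat \<Rightarrow> real"
  assumes nn: "\<And>n. 0 \<le> M n" and d: "0 < \<delta>"
    and ev: "eventually (\<lambda>n. M (Suc n) \<le> (1 - \<delta> / real (Suc n)) * M n) sequentially"
  shows "summable (\<lambda>n. M n / real (Suc n))" and "M \<longlonglongrightarrow> 0"
proof -
  obtain n0 where n0: "\<And>n. n \<ge> n0 \<Longrightarrow> M (Suc n) \<le> (1 - \<delta> / real (Suc n)) * M n"
    using ev by (auto simp: eventually_sequentially)
  have drop: "\<delta> * (M n / real (Suc n)) \<le> M n - M (Suc n)" if "n \<ge> n0" for n
    using n0[OF that] by (simp add: algebra_simps)
  have dec: "decseq (\<lambda>n. M (n + n0))"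
  proof (rule decseq_SucI)
    fix n show "M (Suc n + n0) \<le> M (n + n0)"
      using drop[of "n + n0"] nn[of "n + n0"] d
      by (smt (verit) add_Suc divide_nonneg_nonneg le_add2 mult_nonneg_nonneg of_nat_0_le_iff)
  qed
  then obtain l where "(\<lambda>n. M (n + n0)) \<longlonglongrightarrow> l"
    using decseq_convergent[OF dec, of 0] nn by blast
  hence l: "M \<longlonglongrightarrow> l" by (rule LIMSEQ_offset)
  have "summable (\<lambda>n. M n - M (Suc n))"
    using telescope_summable'[OF l] by simp
  hence "summable (\<lambda>n. \<delta> * (M n / real (Suc n)))"
  proof (rule summable_comparison_test_ev[rotated], intro eventually_sequentiallyI[of n0])
    fix n assume "n0 \<le> n"
    thus "norm (\<delta> * (M n / real (Suc n))) \<le> M n - M (Suc n)"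
      using drop[of n] nn[of n] d by simp
  qed
  from summable_mult[OF this, of "1 / \<delta>"] show s: "summable (\<lambda>n. M n / real (Suc n))"
    using d by simp
  have "l \<ge> 0" using l nn by (metis LIMSEQ_le_const)
  moreover have "\<not> l > 0"
  proof
    assume "l > 0"
    have "eventually (\<lambda>n. l / 2 < M n) sequentially"
      using order_tendstoD(1)[OF l, of "l / 2"] \<open>l > 0\<close> by simp
    hence "eventually (\<lambda>n. (l / 2) / real (Suc n) \<le> M n / real (Suc n)) sequentially"
      by eventually_elim (intro divide_right_mono, auto)
    with not_summable_if_ge_harmonic[of "l / 2"] \<open>l > 0\<close> s show False by simp
  qed
  ultimately show "M \<longlonglongrightarrow> 0" using l by simp
qed

text \<open>
  Writing $N = n+1$ and $a = \Re\mu$, the step multiplies $|L|$ by at most $1 - 3/(8N)$ and $|x|$ by about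
  $1 - a/N$, with cross terms $O(N^{-2})\,|x|$ and $|L|/N$.  The weight $1/8$ on $|x|$ turns the second
  cross term into $|L|/(8N)$, which leaves $1/4 \ge a/2$ of the gain $3/8$; the other one is absorbed by
  the gain in $|x|$.  The two size conditions on $n$ control, in turn, $|N + \mu|$ and the term $\mu^3 x_n$.
\<close>

lemma ladder_contraction:
  assumes eig: "jacobi_eigen \<mu> x" and re: "0 < Re \<mu>" "Re \<mu> \<le> 1 / 2"
    and big: "4 * (norm \<mu>)\<^sup>2 \<le> real (Suc n)" "96 * norm \<mu> ^ 3 / Re \<mu> \<le> real (Suc n)"
  shows "norm (ladder \<mu> x (Suc n)) + norm (x (Suc n)) / 8
         \<le> (1 - (Re \<mu> / 2) / real (Suc n)) * (norm (ladder \<mu> x n) + norm (x n) / 8)"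
proof -
  define N where "N = real (Suc n)"
  define a where "a = Re \<mu>"
  define K where "K = norm \<mu> ^ 3"
  define l where "l = norm (ladder \<mu> x n)"
  define l' where "l' = norm (ladder \<mu> x (Suc n))"
  define u where "u = norm (x n)"
  define u' where "u' = norm (x (Suc n))"
  have N: "N \<ge> 1" and a: "0 < a" "a \<le> 1/2" and nonneg: "l \<ge> 0" "l' \<ge> 0" "u \<ge> 0" "u' \<ge> 0" "K \<ge> 0"
    using re by (auto simp: N_def a_def l_def l'_def u_def u'_def K_def)
  have Nmu: "of_nat (Suc n) + \<mu> = Complex (N + a) (Im \<mu>)"
    by (simp add: complex_eq_iff N_def a_def)
  have up: "norm (of_nat (Suc n) + \<mu>) \<le> N + 5/8"
  proof (rule power2_le_imp_le)
    have "(norm (of_nat (Suc n) + \<mu>))\<^sup>2 = N\<^sup>2 + 2 * (N * a) + (norm \<mu>)\<^sup>2"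
      unfolding Nmu cmod_power2 by (simp add: a_def power2_eq_square algebra_simps)
    also have "N * a \<le> N * (1/2)" using a N by (intro mult_left_mono) auto
    also have "(norm \<mu>)\<^sup>2 \<le> N / 4" using big(1) by (simp add: N_def)
    finally show "(norm (of_nat (Suc n) + \<mu>))\<^sup>2 \<le> (N + 5/8)\<^sup>2"
      by (simp add: power2_eq_square algebra_simps)
  qed (use N in auto)
  have lo: "N + a \<le> norm (of_nat (Suc n) + \<mu>)"
    using complex_Re_le_cmod[of "of_nat (Suc n) + \<mu>"] unfolding Nmu by simp
  have "N\<^sup>2 * l' = norm ((of_nat (Suc n))\<^sup>2 * ladder \<mu> x (Suc n))"
    by (simp add: norm_mult norm_power N_def l'_def del: of_nat_Suc)
  also have "\<dots> \<le> norm (of_nat n * (of_nat (Suc n) + \<mu>) * ladder \<mu> x n) + norm (\<mu> ^ 3 * x n)"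
    unfolding ladder_Suc[OF eig] by (rule norm_triangle_ineq)
  also have "norm (of_nat n * (of_nat (Suc n) + \<mu>) * ladder \<mu> x n) = ((N - 1) * norm (of_nat (Suc n) + \<mu>)) * l"
    by (simp add: norm_mult N_def l_def)
  also have "norm (\<mu> ^ 3 * x n) = K * u" by (simp add: norm_mult norm_power K_def u_def)
  also have "(N - 1) * norm (of_nat (Suc n) + \<mu>) * l \<le> (N\<^sup>2 - 3/8 * N) * l"
  proof (intro mult_right_mono)
    have "(N - 1) * norm (of_nat (Suc n) + \<mu>) \<le> (N - 1) * (N + 5/8)"
      using up N by (intro mult_left_mono) auto
    also have "\<dots> \<le> N\<^sup>2 - 3/8 * N" by (simp add: algebra_simps power2_eq_square)
    finally show "(N - 1) * norm (of_nat (Suc n) + \<mu>) \<le> N\<^sup>2 - 3/8 * N" .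
  qed (use nonneg in auto)
  finally have L: "l' \<le> (1 - 3 / (8 * N)) * l + K / N\<^sup>2 * u"
    using N by (simp add: field_simps power2_eq_square)
  have "(N + a) * u' \<le> norm ((of_nat (Suc n) + \<mu>) * x (Suc n))"
    using lo nonneg by (simp add: norm_mult u'_def mult_right_mono)
  also have "\<dots> \<le> N * u + l'"
    unfolding ladder_factor using norm_triangle_ineq[of "of_nat (Suc n) * x n" "ladder \<mu> x (Suc n)"]
    by (simp add: norm_mult N_def u_def l'_def del: of_nat_Suc)
  finally have "u' \<le> (N * u + l') / (N + a)"
    using N a by (simp add: pos_le_divide_eq mult.commute)
  hence "u' \<le> N / (N + a) * u + l' / (N + a)" by (simp add: add_divide_distrib)
  also have "l' / (N + a) \<le> l' / N" using N a nonneg by (intro divide_left_mono) auto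
  also have "N / (N + a) * u \<le> (1 - 2 * a / (3 * N)) * u"
  proof (intro mult_right_mono)
    have "a * (2 * a) \<le> a * N" using a N by (intro mult_left_mono) auto
    thus "N / (N + a) \<le> 1 - 2 * a / (3 * N)" using N a by (simp add: field_simps)
  qed (use nonneg in auto)
  finally have U: "u' \<le> (1 - 2 * a / (3 * N)) * u + l' / N" by simp
  have "l' + u' / 8 \<le> (1 + 1 / (8 * N)) * l' + (1 - 2 * a / (3 * N)) * u / 8"
  proof -
    have "(1 + 1 / (8 * N)) * l' = l' + l' / N / 8" by (simp add: algebra_simps)
    moreover have "l' + u' / 8 \<le> (l' + l' / N / 8) + A / 8" if "u' \<le> A + l' / N" for A
      using that by simp
    from this[OF U] have "l' + u' / 8 \<le> (l' + l' / N / 8) + (1 - 2 * a / (3 * N)) * u / 8" .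
    ultimately show ?thesis by simp
  qed
  also have "(1 + 1 / (8 * N)) * l' \<le> (1 + 1 / (8 * N)) * ((1 - 3 / (8 * N)) * l + K / N\<^sup>2 * u)"
    using L N by (intro mult_left_mono) auto
  also have "\<dots> \<le> (1 - a / 2 / N) * l + a / (48 * N) * u"
  proof -
    have "(1 + 1 / (8 * N)) * (1 - 3 / (8 * N)) \<le> 1 - 1 / 4 / N"
      using N by (simp add: field_simps power2_eq_square)
    moreover have "a / 2 / N \<le> 1 / 4 / N" using a N by (intro divide_right_mono) auto
    ultimately have "(1 + 1 / (8 * N)) * (1 - 3 / (8 * N)) \<le> 1 - a / 2 / N" by linarith
    hence 1: "(1 + 1 / (8 * N)) * ((1 - 3 / (8 * N)) * l) \<le> (1 - a / 2 / N) * l"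
      using nonneg by (metis mult.assoc mult_right_mono)
    have "96 * K \<le> a * N" using big(2) a by (simp add: K_def a_def N_def field_simps)
    hence "(2 * K) / N\<^sup>2 \<le> (a * N / 48) / N\<^sup>2" by (intro divide_right_mono) auto
    hence "2 * (K / N\<^sup>2) \<le> a / (48 * N)" using N by (simp add: power2_eq_square)
    moreover have "(1 + 1 / (8 * N)) * (K / N\<^sup>2) \<le> 2 * (K / N\<^sup>2)"
      using N nonneg by (intro mult_right_mono) auto
    ultimately have 2: "(1 + 1 / (8 * N)) * (K / N\<^sup>2 * u) \<le> a / (48 * N) * u"
      using nonneg by (metis mult.assoc mult_right_mono order_trans)
    from 1 2 show ?thesis by (simp only: distrib_left)
  qed
  also have "(1 - a / 2 / N) * l + a / (48 * N) * u + (1 - 2 * a / (3 * N)) * u / 8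
             = (1 - a / 2 / N) * (l + u / 8)"
    using N by (simp add: field_simps)
  finally show ?thesis by (simp add: N_def a_def l_def l'_def u_def u'_def)
qed

lemma jacobi_eigen_decay:
  assumes eig: "jacobi_eigen \<mu> x" and re: "0 < Re \<mu>" "Re \<mu> \<le> 1 / 2"
  shows "summable (\<lambda>n. norm (x n) / real (Suc n))" and "x \<longlonglongrightarrow> 0"
    and "ladder \<mu> x \<longlonglongrightarrow> 0"
proof -
  define M where "M n = norm (ladder \<mu> x n) + norm (x n) / 8" for n
  have large: "eventually (\<lambda>n. c \<le> real (Suc n)) sequentially" for c
    using filterlim_compose[OF filterlim_real_sequentially filterlim_Suc]
    by (simp add: filterlim_at_top)
  have ev: "eventually (\<lambda>n. M (Suc n) \<le> (1 - (Re \<mu> / 2) / real (Suc n)) * M n) sequentially"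
    using large[of "4 * (norm \<mu>)\<^sup>2"] large[of "96 * norm \<mu> ^ 3 / Re \<mu>"]
    unfolding M_def by eventually_elim (rule ladder_contraction[OF eig re])
  have nn: "M n \<ge> 0" for n by (simp add: M_def)
  note decay = log_decay[OF nn _ ev]
  have sm: "summable (\<lambda>n. 8 * (M n / real (Suc n)))" using decay(1) re by (intro summable_mult) auto
  show "summable (\<lambda>n. norm (x n) / real (Suc n))"
    by (rule summable_comparison_test'[OF sm, of 0]) (auto simp: M_def field_simps)
  have M0: "M \<longlonglongrightarrow> 0" using decay(2) re by simp
  from tendsto_mult_right_zero[OF M0, of 8] show "x \<longlonglongrightarrow> 0"
    by (rule Lim_null_comparison[rotated]) (auto simp: M_def)
  from M0 show "ladder \<mu> x \<longlonglongrightarrow> 0"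
    by (rule Lim_null_comparison[rotated]) (auto simp: M_def)
qed

section \<open>Summation by parts\<close>

lemma jacobi_green:
  "(\<Sum>n<N. w n * jacobi x n - jacobi w n * x n)
   = (of_nat N)\<^sup>2 * ((x N - x (N - 1)) * w N - x N * (w N - w (N - 1)))"
proof (induction N)
  case (Suc N)
  thus ?case unfolding sum.lessThan_Suc Suc.IH
    by (simp add: jacobi_def flux_def algebra_simps)
qed simp

text \<open>
  Both sorts of weights used below, rows of the Hilbert matrix and beta weights, are $O(1/n)$ with
  increments $O(1/n^2)$.  For these the boundary term of \<open>jacobi_green\<close> is controlled by
  $n(x_n - x_{n-1})$ and $x_n$, which tend to $0$.
\<close>

lemma jacobi_adjoint_sums:
  assumes eig: "jacobi_eigen \<mu> x" and re: "0 < Re \<mu>" "Re \<mu> \<le> 1 / 2"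
    and w: "\<And>n. norm (w n) \<le> 1 / real (Suc n)"
    and dw: "\<And>n. (real n)\<^sup>2 * norm (w n - w (n - 1)) \<le> C"
  shows "summable (\<lambda>n. w n * x n)"
    and "(\<lambda>n. jacobi w n * x n) sums (- (\<mu> * (1 - \<mu>)) * (\<Sum>n. w n * x n))"
proof -
  note decay = jacobi_eigen_decay[OF eig re]
  show sm: "summable (\<lambda>n. w n * x n)"
  proof (rule summable_comparison_test'[OF decay(1), of 0])
    fix n show "norm (w n * x n) \<le> norm (x n) / real (Suc n)"
      using mult_right_mono[OF w[of n] norm_ge_zero[of "x n"]] by (simp add: norm_mult)
  qed
  define b where "b N = (of_nat N)\<^sup>2 * ((x N - x (N - 1)) * w N - x N * (w N - w (N - 1)))" for N
  have "norm (b N) \<le> norm (ladder \<mu> x N - \<mu> * x N) + C * norm (x N)" for N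
  proof -
    have "b N = (ladder \<mu> x N - \<mu> * x N) * (of_nat N * w N) - x N * ((of_nat N)\<^sup>2 * (w N - w (N - 1)))"
      by (simp add: b_def ladder_def algebra_simps power2_eq_square)
    also have "norm \<dots> \<le> norm (ladder \<mu> x N - \<mu> * x N) * norm (of_nat N * w N)
                     + norm (x N) * norm ((of_nat N)\<^sup>2 * (w N - w (N - 1)))"
      by (rule order_trans[OF norm_triangle_ineq4]) (simp add: norm_mult)
    also have "\<dots> \<le> norm (ladder \<mu> x N - \<mu> * x N) * 1 + norm (x N) * C"
    proof (intro add_mono mult_left_mono)
      have "real N * norm (w N) \<le> real N * (1 / real (Suc N))" by (intro mult_left_mono w) auto
      also have "\<dots> \<le> 1" by simp
      finally show "norm (of_nat N * w N) \<le> 1" by (simp add: norm_mult)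
      show "norm ((of_nat N)\<^sup>2 * (w N - w (N - 1))) \<le> C"
        using dw[of N] by (simp add: norm_mult norm_power)
    qed auto
    finally show ?thesis by (simp add: mult.commute)
  qed
  moreover have "(\<lambda>N. norm (ladder \<mu> x N - \<mu> * x N) + C * norm (x N)) \<longlonglongrightarrow> norm (0 - \<mu> * 0) + C * norm (0 :: complex)"
    by (intro tendsto_intros decay)
  ultimately have b0: "b \<longlonglongrightarrow> 0"
    by (intro Lim_null_comparison[where f = b] always_eventually allI) auto
  have "(\<Sum>n<N. jacobi w n * x n) = - (\<mu> * (1 - \<mu>)) * (\<Sum>n<N. w n * x n) - b N" for N
  proof -
    have "b N = (\<Sum>n<N. w n * jacobi x n) - (\<Sum>n<N. jacobi w n * x n)"
      unfolding b_def jacobi_green[symmetric] by (rule sum_subtractf)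
    also have "(\<Sum>n<N. w n * jacobi x n) = - (\<mu> * (1 - \<mu>)) * (\<Sum>n<N. w n * x n)"
      using eig unfolding jacobi_eigen_def sum_distrib_left by (intro sum.cong) auto
    finally show ?thesis by simp
  qed
  moreover have "(\<lambda>N. - (\<mu> * (1 - \<mu>)) * (\<Sum>n<N. w n * x n) - b N)
       \<longlonglongrightarrow> - (\<mu> * (1 - \<mu>)) * (\<Sum>n. w n * x n) - 0"
    by (intro tendsto_intros b0 summable_LIMSEQ sm)
  ultimately show "(\<lambda>n. jacobi w n * x n) sums (- (\<mu> * (1 - \<mu>)) * (\<Sum>n. w n * x n))"
    unfolding sums_def by simp
qed

section \<open>Commutation with the Hilbert matrix\<close>

lemma hilbert_matrix_diff:
  "(of_nat n)\<^sup>2 * (hilbert_matrix i n - hilbert_matrix i (n - 1))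
   = - ((of_nat n)\<^sup>2 / (of_nat (n + i) * of_nat (n + i + 1)))"
proof (cases n)
  case (Suc m)
  have "(of_nat (i + m + 1) :: complex) \<noteq> 0" "(of_nat (i + m + 2) :: complex) \<noteq> 0"
    by (simp_all only: of_nat_eq_0_iff)
  thus ?thesis unfolding Suc hilbert_matrix_def
    by (simp add: divide_simps) (simp add: algebra_simps)
qed simp

text \<open>
  Both sides equal $-(2ni+n+i)/((n+i)(n+i+1)(n+i+2))$, which is symmetric in $n$ and $i$.  For
  $n = i = 0$ this formula degenerates, but then the two sides coincide by symmetry of the matrix.
\<close>

lemma jacobi_hilbert_matrix_commute:
  "jacobi (\<lambda>m. hilbert_matrix i m) n = jacobi (\<lambda>j. hilbert_matrix j n) i"
proof -
  have sym: "hilbert_matrix a b = hilbert_matrix b a" for a b by (simp add: hilbert_matrix_def add.commute)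
  have J: "jacobi (\<lambda>m. hilbert_matrix i m) n
     = (of_nat n)\<^sup>2 / (of_nat (n + i) * of_nat (n + i + 1))
       - (of_nat (Suc n))\<^sup>2 / (of_nat (n + i + 1) * of_nat (n + i + 2))" for i n
    unfolding jacobi_def flux_def hilbert_matrix_diff by simp
  show ?thesis
  proof (cases "n + i = 0")
    case False
    hence "(of_nat (n + i) :: complex) \<noteq> 0" "(of_nat (n + i + 1) :: complex) \<noteq> 0" "(of_nat (n + i + 2) :: complex) \<noteq> 0"
      by (simp_all only: of_nat_eq_0_iff) auto
    hence nz: "of_nat n + of_nat i \<noteq> (0::complex)" "of_nat n + of_nat i + 1 \<noteq> (0::complex)"
      "of_nat n + of_nat i + 2 \<noteq> (0::complex)"
      by (simp_all add: add_ac)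
    have "(of_nat n)\<^sup>2 / ((of_nat n + of_nat i) * (of_nat n + of_nat i + 1))
       - (of_nat n + 1)\<^sup>2 / ((of_nat n + of_nat i + 1) * (of_nat n + of_nat i + 2))
      = - (2 * of_nat n * of_nat i + of_nat n + of_nat i) /
          ((of_nat n + of_nat i) * (of_nat n + of_nat i + 1) * (of_nat n + of_nat i + 2) :: complex)"
      if "of_nat n + of_nat i \<noteq> (0::complex)" "of_nat n + of_nat i + 1 \<noteq> (0::complex)"
      "of_nat n + of_nat i + 2 \<noteq> (0::complex)" for n i
      using that by (simp add: divide_simps) (simp add: algebra_simps power2_eq_square)
    note E = this
    show ?thesis
      unfolding J sym[of _ n] using E[OF nz] E[of i n] nz
      by (simp add: add_ac mult_ac)
  qed (simp add: sym)
qed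

lemma hilbert_weight_bounds:
  "norm (hilbert_matrix i n) \<le> 1 / real (Suc n)"
  "(real n)\<^sup>2 * norm (hilbert_matrix i n - hilbert_matrix i (n - 1)) \<le> 1"
proof -
  have "norm (hilbert_matrix i n) = 1 / real (i + n + 1)"
    unfolding hilbert_matrix_def norm_divide norm_one norm_of_nat ..
  also have "\<dots> \<le> 1 / real (Suc n)" by (intro divide_left_mono) auto
  finally show "norm (hilbert_matrix i n) \<le> 1 / real (Suc n)" .
  have "(real n)\<^sup>2 * norm (hilbert_matrix i n - hilbert_matrix i (n - 1))
        = norm ((of_nat n)\<^sup>2 * (hilbert_matrix i n - hilbert_matrix i (n - 1)))"
    by (simp add: norm_mult norm_power)
  also have "\<dots> = (real n)\<^sup>2 / (real (n + i) * real (n + i + 1))"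
    unfolding hilbert_matrix_diff norm_minus_cancel norm_divide norm_mult norm_power norm_of_nat ..
  also have "\<dots> \<le> 1"
  proof (cases "n = 0")
    case False
    have "(real n)\<^sup>2 \<le> real (n + i) * real (n + i + 1)"
      unfolding power2_eq_square by (intro mult_mono) auto
    thus ?thesis using False by (intro divide_le_eq_1_pos[THEN iffD2]) auto
  qed simp
  finally show "(real n)\<^sup>2 * norm (hilbert_matrix i n - hilbert_matrix i (n - 1)) \<le> 1" .
qed

lemma hilbert_apply_eigen:
  assumes eig: "jacobi_eigen \<mu> x" and re: "0 < Re \<mu>" "Re \<mu> \<le> 1 / 2"
  shows "x \<in> hilbert_domain" and "jacobi_eigen \<mu> (hilbert_apply x)"
proof -
  have sm: "summable (\<lambda>n. hilbert_matrix i n * x n)"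
    and adj: "(\<lambda>n. jacobi (hilbert_matrix i) n * x n) sums
        (- (\<mu> * (1 - \<mu>)) * (\<Sum>n. hilbert_matrix i n * x n))" for i
    using jacobi_adjoint_sums[OF eig re, of "hilbert_matrix i", OF hilbert_weight_bounds] .
  show "x \<in> hilbert_domain" using sm by (simp add: hilbert_domain_def)
  show "jacobi_eigen \<mu> (hilbert_apply x)"
    unfolding jacobi_eigen_def
  proof
    fix i
    let ?h = "\<lambda>j. \<Sum>n. hilbert_matrix j n * x n"
    have "(\<lambda>n. jacobi (\<lambda>j. hilbert_matrix j n) i * x n) sums jacobi ?h i"
    proof -
      have "(\<lambda>n. (of_nat (Suc i))\<^sup>2 * (hilbert_matrix (Suc i) n * x n - hilbert_matrix i n * x n)
          - (of_nat i)\<^sup>2 * (hilbert_matrix i n * x n - hilbert_matrix (i - 1) n * x n)) sums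
          ((of_nat (Suc i))\<^sup>2 * (?h (Suc i) - ?h i) - (of_nat i)\<^sup>2 * (?h i - ?h (i - 1)))"
        by (intro sums_diff sums_mult summable_sums sm)
      thus ?thesis unfolding jacobi_def flux_def diff_Suc_1 by (simp only: left_diff_distrib mult.assoc)
    qed
    moreover have "(\<lambda>n. jacobi (\<lambda>j. hilbert_matrix j n) i * x n) sums (- (\<mu> * (1 - \<mu>)) * ?h i)"
      using adj[of i] unfolding jacobi_hilbert_matrix_commute .
    ultimately have "jacobi ?h i = - (\<mu> * (1 - \<mu>)) * ?h i" by (rule sums_unique2)
    thus "jacobi (hilbert_apply x) i = - (\<mu> * (1 - \<mu>)) * hilbert_apply x i"
      unfolding hilbert_apply_def[abs_def] .
  qed
qed

section \<open>The eigenvalue through beta moments\<close>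

text \<open>
  The beta integral $\int_0^1 t^n (1-t)^m\,dt$.  For $m = 0$ it is the first row of the Hilbert matrix.
\<close>

definition beta_weight :: "nat \<Rightarrow> nat \<Rightarrow> complex" where
  "beta_weight m n = fact n * fact m / fact (n + m + 1)"

lemma beta_weight_Suc:
  "of_nat (n + m + 2) * beta_weight m (Suc n) = of_nat (Suc n) * beta_weight m n"
  "of_nat (n + m + 2) * beta_weight (Suc m) n = of_nat (Suc m) * beta_weight m n"
proof -
  have f: "fact (Suc (n + m + 1)) = (of_nat (n + m + 2) * fact (n + m + 1) :: complex)"
    unfolding fact_Suc by (simp add: algebra_simps)
  have nz: "of_nat (n + m + 2) \<noteq> (0 :: complex)" by (simp only: of_nat_eq_0_iff)
  have cancel: "c * (s * a * b / (c * d)) = s * (a * b / d)" if "c \<noteq> 0" for a b c d s :: complex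
    using that by simp
  have e: "Suc n + m + 1 = Suc (n + m + 1)" "n + Suc m + 1 = Suc (n + m + 1)" by auto
  show "of_nat (n + m + 2) * beta_weight m (Suc n) = of_nat (Suc n) * beta_weight m n"
    unfolding beta_weight_def e f fact_Suc[of n] using cancel[OF nz] .
  show "of_nat (n + m + 2) * beta_weight (Suc m) n = of_nat (Suc m) * beta_weight m n"
    unfolding beta_weight_def e f fact_Suc[of m] using cancel[OF nz, of _ "fact m" "fact n"]
    by (simp add: mult_ac del: of_nat_Suc)
qed

lemma flux_beta_weight:
  "flux (beta_weight m) n = - (of_nat n * of_nat (Suc m) * beta_weight m n)"
proof (cases n)
  case (Suc k)
  have "of_nat (Suc k) * (beta_weight m (Suc k) - beta_weight m k)
        = - (of_nat (Suc m) * beta_weight m (Suc k))"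
    using beta_weight_Suc(1)[of k m] by (simp add: algebra_simps)
  thus ?thesis unfolding flux_def Suc
    by (simp add: power2_eq_square mult.assoc del: of_nat_Suc)
qed (simp add: flux_def)

text \<open>
  $J$ is bidiagonal in $m$ on beta weights.  Summed against an eigenvector this becomes the recurrence
  \<open>gamma_coeff_Suc\<close> for the moments.
\<close>

lemma jacobi_beta_weight:
  "jacobi (beta_weight m) n
   = of_nat m * of_nat (Suc m) * beta_weight m n - (of_nat (Suc m))\<^sup>2 * beta_weight (Suc m) n"
proof -
  have nz: "of_nat (n + m + 2) \<noteq> (0 :: complex)" by (simp only: of_nat_eq_0_iff)
  have "of_nat (n + m + 2) * jacobi (beta_weight m) n
        = of_nat (Suc m) * (of_nat n * of_nat (n + m + 2) * beta_weight m n
            - of_nat (Suc n) * (of_nat (n + m + 2) * beta_weight m (Suc n)))"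
    unfolding jacobi_def flux_beta_weight by (simp add: algebra_simps)
  also have "\<dots> = of_nat m * of_nat (Suc m) * of_nat (n + m + 2) * beta_weight m n
        - (of_nat (Suc m))\<^sup>2 * (of_nat (n + m + 2) * beta_weight (Suc m) n)"
    unfolding beta_weight_Suc by (simp add: algebra_simps power2_eq_square)
  also have "\<dots> = of_nat (n + m + 2) * (of_nat m * of_nat (Suc m) * beta_weight m n
        - (of_nat (Suc m))\<^sup>2 * beta_weight (Suc m) n)"
    by (simp add: right_diff_distrib mult_ac)
  finally show ?thesis using nz by (simp only: mult_cancel_left) simp
qed

lemma norm_beta_weight: "norm (beta_weight m n) = fact n * fact m / fact (n + m + 1)"
  unfolding beta_weight_def norm_divide norm_mult norm_fact ..

lemma beta_weight_bounds:
  "norm (beta_weight m n) \<le> 1 / real (Suc n)"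
  "(real n)\<^sup>2 * norm (beta_weight m n - beta_weight m (n - 1)) \<le> real (Suc m)"
proof -
  have "fact (Suc n) * fact m \<le> (fact (Suc n + m) :: nat)"
    by (intro dvd_imp_le fact_fact_dvd_fact) simp
  hence "real (fact (Suc n) * fact m) \<le> real (fact (n + m + 1))"
    by (simp only: of_nat_le_iff) simp
  hence "real (Suc n) * (fact n * fact m) \<le> fact (n + m + 1)"
    by (simp only: of_nat_mult of_nat_fact fact_Suc of_nat_id mult.assoc)
  thus 1: "norm (beta_weight m n) \<le> 1 / real (Suc n)"
    unfolding norm_beta_weight by (simp add: field_simps del: fact_Suc)
  have "(real n)\<^sup>2 * norm (beta_weight m n - beta_weight m (n - 1)) = norm (flux (beta_weight m) n)"
    by (simp add: flux_def norm_mult norm_power)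
  also have "\<dots> = real (Suc m) * (real n * norm (beta_weight m n))"
    unfolding flux_beta_weight norm_minus_cancel norm_mult norm_of_nat by simp
  also have "\<dots> \<le> real (Suc m) * 1"
  proof (intro mult_left_mono)
    have "real n * norm (beta_weight m n) \<le> real n * (1 / real (Suc n))"
      by (intro mult_left_mono 1) auto
    also have "\<dots> \<le> 1" by simp
    finally show "real n * norm (beta_weight m n) \<le> 1" .
  qed auto
  finally show "(real n)\<^sup>2 * norm (beta_weight m n - beta_weight m (n - 1)) \<le> real (Suc m)" by simp
qed

lemma fact_mult_fact_le: "fact (k + 2) * fact (m + 2) \<le> 2 * (fact (k + m + 2) :: nat)"
proof (induction k)
  case (Suc k)
  have e: "Suc k + 2 = Suc (k + 2)" "Suc k + m + 2 = Suc (k + m + 2)" by auto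
  have "fact (Suc k + 2) * fact (m + 2) = Suc (k + 2) * (fact (k + 2) * fact (m + 2) :: nat)"
    unfolding e fact_Suc of_nat_id by (rule mult.assoc)
  also have "\<dots> \<le> Suc (k + m + 2) * (2 * fact (k + m + 2))"
    by (rule mult_mono[OF _ Suc]) simp_all
  also have "\<dots> = 2 * fact (Suc k + m + 2)"
    unfolding e fact_Suc of_nat_id by (rule mult.left_commute)
  finally show ?case .
qed (simp add: fact_numeral)

text \<open>
  For $n \ge 1$ the rescaled weights $(m+1)\,w_m(n)$ tend to $0$ as $m \to \infty$, dominated by the
  weights $1/(n+1)$ against which $|x_n|$ is summable, while $(m+1)\,w_m(0) = 1$.  This is what isolates
  $x_0$ in the limit of the moments.
\<close>

lemma beta_weight_tail:
  assumes "n > 0"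
  shows "real (Suc m) * norm (beta_weight m n) \<le> (2 / real (m + 2)) * (1 / real (Suc n))"
proof -
  obtain k where n: "n = Suc k" using assms gr0_implies_Suc by blast
  have e: "k + m + 2 = n + m + 1" by (simp add: n)
  have "real (fact (k + 2) * fact (m + 2)) \<le> real (2 * fact (k + m + 2))"
    using fact_mult_fact_le by (simp only: of_nat_le_iff)
  moreover have "real (fact (k + 2) * fact (m + 2))
      = real (Suc n) * fact n * (real (m + 2) * (real (Suc m) * fact m))"
    unfolding n by (simp add: algebra_simps)
  ultimately have "real (Suc n) * fact n * (real (m + 2) * (real (Suc m) * fact m)) \<le> 2 * fact (n + m + 1)"
    by (simp only: e of_nat_mult of_nat_numeral of_nat_fact)
  moreover have "(0::real) < fact (n + m + 1)" "0 < real (Suc n)" "0 < real (m + 2)" by simp_all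
  moreover have "s * (a * b / f) \<le> 2 / r * (1 / q)"
    if "q * a * (r * (s * b)) \<le> 2 * f" "0 < f" "0 < q" "0 < r" for a b f q r s :: real
    using that by (simp add: field_simps)
  ultimately show ?thesis unfolding norm_beta_weight by blast
qed

lemma beta_weight_moments:
  assumes eig: "jacobi_eigen \<mu> x" and re: "0 < Re \<mu>" "Re \<mu> \<le> 1 / 2"
  defines "Z \<equiv> \<lambda>m. \<Sum>n. beta_weight m n * x n"
  shows "(of_nat (Suc m))\<^sup>2 * Z (Suc m) = (of_nat m * of_nat (Suc m) + \<mu> * (1 - \<mu>)) * Z m"
    and "(\<lambda>m. of_nat (Suc m) * Z m) \<longlonglongrightarrow> x 0"
proof -
  have sm: "summable (\<lambda>n. beta_weight m n * x n)"
    and adj: "(\<lambda>n. jacobi (beta_weight m) n * x n) sums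
        (- (\<mu> * (1 - \<mu>)) * (\<Sum>n. beta_weight m n * x n))" for m
    using jacobi_adjoint_sums[OF eig re, of "beta_weight m", OF beta_weight_bounds] .
  have "(\<lambda>n. of_nat m * of_nat (Suc m) * (beta_weight m n * x n)
         - (of_nat (Suc m))\<^sup>2 * (beta_weight (Suc m) n * x n))
        sums (of_nat m * of_nat (Suc m) * Z m - (of_nat (Suc m))\<^sup>2 * Z (Suc m))"
    unfolding Z_def by (intro sums_diff sums_mult summable_sums sm)
  moreover have "(\<lambda>n. of_nat m * of_nat (Suc m) * (beta_weight m n * x n)
         - (of_nat (Suc m))\<^sup>2 * (beta_weight (Suc m) n * x n)) sums (- (\<mu> * (1 - \<mu>)) * Z m)"
    using adj[of m] unfolding jacobi_beta_weight Z_def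
    by (simp only: left_diff_distrib mult.assoc)
  ultimately have "of_nat m * of_nat (Suc m) * Z m - (of_nat (Suc m))\<^sup>2 * Z (Suc m) = - (\<mu> * (1 - \<mu>)) * Z m"
    by (rule sums_unique2)
  thus "(of_nat (Suc m))\<^sup>2 * Z (Suc m) = (of_nat m * of_nat (Suc m) + \<mu> * (1 - \<mu>)) * Z m"
    by (simp add: algebra_simps)
  define s where "s n = norm (x n) / real (Suc n)" for n
  have s: "summable s" unfolding s_def by (rule jacobi_eigen_decay[OF eig re])
  have bound: "norm (of_nat (Suc m) * Z m - x 0) \<le> 2 / real (m + 2) * (\<Sum>n. s n)" for m
  proof -
    define t where "t n = of_nat (Suc m) * (beta_weight m (Suc n) * x (Suc n))" for n
    have sm': "summable (\<lambda>n. of_nat (Suc m) * (beta_weight m n * x n))"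
      by (intro summable_mult sm)
    have "of_nat (Suc m) * beta_weight m 0 = 1"
      unfolding beta_weight_def by (simp del: of_nat_Suc)
    hence "of_nat (Suc m) * Z m - x 0 = (\<Sum>n. t n)"
      unfolding Z_def suminf_mult[OF sm, symmetric] t_def
      using suminf_split_head[OF sm'] by (simp add: mult.assoc[symmetric] del: of_nat_Suc)
    also have "norm \<dots> \<le> (\<Sum>n. 2 / real (m + 2) * s (Suc n))"
    proof (rule norm_suminf_le)
      show "summable (\<lambda>n. 2 / real (m + 2) * s (Suc n))"
        using s by (intro summable_mult) (simp add: summable_Suc_iff)
      fix n
      have "norm (t n) = real (Suc m) * norm (beta_weight m (Suc n)) * norm (x (Suc n))"
        unfolding t_def norm_mult norm_of_nat by simp
      also have "\<dots> \<le> 2 / real (m + 2) * (1 / real (Suc (Suc n))) * norm (x (Suc n))"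
        by (intro mult_right_mono beta_weight_tail) auto
      finally show "norm (t n) \<le> 2 / real (m + 2) * s (Suc n)" by (simp add: s_def)
    qed
    also have "\<dots> = 2 / real (m + 2) * (\<Sum>n. s (Suc n))"
      using s by (intro suminf_mult) (simp add: summable_Suc_iff)
    also have "\<dots> \<le> 2 / real (m + 2) * (\<Sum>n. s n)"
    proof (rule mult_left_mono)
      have "0 \<le> s 0" by (simp add: s_def)
      thus "(\<Sum>n. s (Suc n)) \<le> (\<Sum>n. s n)" unfolding suminf_split_head[OF s] by simp
    qed simp
    finally show ?thesis .
  qed
  have "(\<lambda>m. 2 / real (m + 2) * (\<Sum>n. s n)) \<longlonglongrightarrow> 0"
  proof -
    have "(\<lambda>m. 2 * inverse (real (Suc (Suc m))) * (\<Sum>n. s n)) \<longlonglongrightarrow> 2 * 0 * (\<Sum>n. s n)"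
      by (intro tendsto_intros filterlim_compose[OF LIMSEQ_inverse_real_of_nat filterlim_Suc])
    thus ?thesis by (simp add: divide_inverse)
  qed
  hence "(\<lambda>m. of_nat (Suc m) * Z m - x 0) \<longlonglongrightarrow> 0"
    by (rule Lim_null_comparison[rotated]) (intro always_eventually allI bound)
  thus "(\<lambda>m. of_nat (Suc m) * Z m) \<longlonglongrightarrow> x 0" by (rule LIM_zero_cancel)
qed

lemma gamma_coeff_0:
  "gamma_coeff \<mu> 0 = of_real pi / sin (of_real pi * \<mu>)"
  using Gamma_reflection_complex[of \<mu>] by (simp add: gamma_coeff_def)

lemma gamma_coeff_nonzero:
  assumes "0 < Re \<mu>" "Re \<mu> < 1"
  shows "gamma_coeff \<mu> k \<noteq> 0"
  using assms by (simp add: gamma_coeff_def Gamma_eq_zero_iff not_nonpos_Int_if_Re_pos)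

text \<open>
  Both Gamma factors are compared with Euler's limit for $\Gamma(\mu)$ and $\Gamma(1-\mu)$.  The powers
  $n^\mu$ and $n^{1-\mu}$ in it multiply to $n$.
\<close>

lemma gamma_coeff_asymp:
  assumes "0 < Re \<mu>" "Re \<mu> < 1"
  shows "(\<lambda>n. of_nat (Suc n) * gamma_coeff \<mu> n) \<longlonglongrightarrow> 1"
proof -
  have np: "\<mu> \<notin> \<int>\<^sub>\<le>\<^sub>0" "1 - \<mu> \<notin> \<int>\<^sub>\<le>\<^sub>0"
    using assms by (auto intro!: not_nonpos_Int_if_Re_pos)
  have c0: "gamma_coeff \<mu> 0 = Gamma \<mu> * Gamma (1 - \<mu>)" by (simp add: gamma_coeff_def)
  have *: "of_nat (Suc n) * gamma_coeff \<mu> n = of_nat (Suc n) / of_nat n *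
      (gamma_coeff \<mu> 0 / (Gamma_series' \<mu> n * Gamma_series' (1 - \<mu>) n))" if "n > 0" for n
  proof -
    have "exp (\<mu> * of_real (ln (real n))) * exp ((1 - \<mu>) * of_real (ln (real n))) = exp (of_real (ln (real n)))"
      unfolding exp_add[symmetric] by (simp add: algebra_simps)
    also have "\<dots> = of_real (exp (ln (real n)))" by (rule exp_of_real)
    also have "\<dots> = of_nat n" using that by (subst exp_ln) auto
    finally have gs: "Gamma_series' \<mu> n * Gamma_series' (1 - \<mu>) n
       = (fact (n - 1))\<^sup>2 * of_nat n / (pochhammer \<mu> n * pochhammer (1 - \<mu>) n)"
      unfolding Gamma_series'_def by (simp add: power2_eq_square mult_ac)
    have "Gamma (of_nat n + 1) = (of_nat n * fact (n - 1) :: complex)"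
      using that Gamma_fact[of n, where 'a = complex] by (simp add: fact_reduce add.commute)
    moreover have shift: "of_nat n + \<mu> = \<mu> + of_nat n" "of_nat n + 1 - \<mu> = 1 - \<mu> + of_nat n"
      by simp_all
    moreover have nz: "Gamma \<mu> \<noteq> 0" "Gamma (1 - \<mu>) \<noteq> 0"
      using np by (simp_all add: Gamma_eq_zero_iff)
    ultimately have "gamma_coeff \<mu> n = gamma_coeff \<mu> 0 * (pochhammer \<mu> n * pochhammer (1 - \<mu>) n) / (of_nat n * fact (n - 1))\<^sup>2"
      unfolding c0 gamma_coeff_def pochhammer_Gamma[OF np(1)] pochhammer_Gamma[OF np(2)]
      unfolding shift by (simp add: nz)
    thus ?thesis unfolding gs using that by (simp add: power2_eq_square)
  qed
  have "(\<lambda>n. of_nat (Suc n) / of_nat n * (gamma_coeff \<mu> 0 / (Gamma_series' \<mu> n * Gamma_series' (1 - \<mu>) n)))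
          \<longlonglongrightarrow> 1 * (gamma_coeff \<mu> 0 / (Gamma \<mu> * Gamma (1 - \<mu>)))"
    by (intro tendsto_intros LIMSEQ_Suc_n_over_n Gamma_series'_LIMSEQ)
       (use np in \<open>auto simp: Gamma_eq_zero_iff\<close>)
  also have "1 * (gamma_coeff \<mu> 0 / (Gamma \<mu> * Gamma (1 - \<mu>))) = 1"
    using np by (simp add: c0 Gamma_eq_zero_iff)
  finally show ?thesis
    by (rule Lim_transform_eventually) (use * in \<open>auto intro!: eventually_sequentiallyI[of 1]\<close>)
qed

text \<open>
  The moments $Z_m$ and the coefficients $c_m$ obey the same first-order recurrence, hence are
  proportional.  Comparing them at $m = 0$ and as $m \to \infty$ yields $Z_0 = c_0 x_0$.
\<close>

lemma hilbert_apply_at_0: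
  assumes eig: "jacobi_eigen \<mu> x" and re: "0 < Re \<mu>" "Re \<mu> \<le> 1 / 2"
  shows "hilbert_apply x 0 = of_real pi / sin (of_real pi * \<mu>) * x 0"
proof -
  have re': "Re \<mu> < 1" using re by simp
  define Z where "Z m = (\<Sum>n. beta_weight m n * x n)" for m
  let ?c = "gamma_coeff \<mu>"
  have Z: "Z 0 * ?c m = ?c 0 * Z m" for m
  proof (induction m)
    case (Suc m)
    have "(of_nat (Suc m))\<^sup>2 * (Z 0 * ?c (Suc m)) = (of_nat m * of_nat (Suc m) + \<mu> * (1 - \<mu>)) * (Z 0 * ?c m)"
      using gamma_coeff_Suc[OF re(1) re', of m] by (metis mult.left_commute)
    also have "\<dots> = (of_nat (Suc m))\<^sup>2 * (?c 0 * Z (Suc m))"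
      unfolding Suc using beta_weight_moments(1)[OF eig re, of m] unfolding Z_def[symmetric]
      by (metis mult.left_commute)
    finally show ?case by (simp del: of_nat_Suc)
  qed simp
  have "(\<lambda>m. Z 0 * (of_nat (Suc m) * ?c m)) \<longlonglongrightarrow> Z 0 * 1"
    by (intro tendsto_intros gamma_coeff_asymp re re')
  moreover have "(\<lambda>m. Z 0 * (of_nat (Suc m) * ?c m)) \<longlonglongrightarrow> ?c 0 * x 0"
  proof -
    have "Z 0 * (of_nat (Suc m) * ?c m) = ?c 0 * (of_nat (Suc m) * Z m)" for m
      using Z[of m] by (metis mult.left_commute)
    moreover have "(\<lambda>m. ?c 0 * (of_nat (Suc m) * Z m)) \<longlonglongrightarrow> ?c 0 * x 0"
      unfolding Z_def by (intro tendsto_mult_left beta_weight_moments(2)[OF eig re])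
    ultimately show ?thesis by presburger
  qed
  ultimately have "Z 0 = ?c 0 * x 0" using LIMSEQ_unique by fastforce
  moreover have "beta_weight 0 n = hilbert_matrix 0 n" for n
    unfolding beta_weight_def hilbert_matrix_def by (simp add: field_simps del: of_nat_Suc)
  ultimately show ?thesis
    unfolding hilbert_apply_def Z_def gamma_coeff_0 by simp
qed

lemma hilbert_apply_eq:
  assumes eig: "jacobi_eigen \<mu> x" and re: "0 < Re \<mu>" "Re \<mu> \<le> 1 / 2" and x0: "x 0 \<noteq> 0"
  shows "hilbert_apply x n = of_real pi / sin (of_real pi * \<mu>) * x n"
proof -
  have "x 0 * hilbert_apply x n = hilbert_apply x 0 * x n"
    by (rule jacobi_eigen_unique[OF eig hilbert_apply_eigen(2)[OF eig re]])
  also have "\<dots> = x 0 * (of_real pi / sin (of_real pi * \<mu>) * x n)"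
    unfolding hilbert_apply_at_0[OF eig re] by (simp add: mult_ac)
  finally show ?thesis using x0 by (metis mult_left_cancel)
qed

section \<open>Solutions are not square-summable\<close>

text \<open>
  Summation by parts of $\overline{x_n}\,(Jx)_n$.  Its real part controls the increments of $x$, its
  imaginary part relates $\sum |x_n|^2$ to the boundary term alone.
\<close>

lemma energy_identity:
  assumes eig: "jacobi_eigen \<mu> x"
  shows "of_real (\<Sum>n<N. (real n * norm (x n - x (n - 1)))\<^sup>2)
         = \<mu> * (1 - \<mu>) * of_real (\<Sum>n<N. (norm (x n))\<^sup>2)
           + (of_nat N)\<^sup>2 * (cnj (x (N - 1)) * (x N - x (N - 1)))"
proof (induction N)
  case (Suc N)
  have sq: "of_real ((norm z)\<^sup>2) = z * cnj z" for z
    using complex_norm_square[of z] by simp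
  have J: "\<mu> * (1 - \<mu>) * x N = (of_nat N)\<^sup>2 * (x N - x (N - 1)) - (of_nat (Suc N))\<^sup>2 * (x (Suc N) - x N)"
    using eig by (simp add: jacobi_eigen_def jacobi_def flux_def algebra_simps)
  have "of_real (\<Sum>n<Suc N. (real n * norm (x n - x (n - 1)))\<^sup>2)
        = \<mu> * (1 - \<mu>) * of_real (\<Sum>n<N. (norm (x n))\<^sup>2)
          + (of_nat N)\<^sup>2 * (cnj (x (N - 1)) * (x N - x (N - 1)))
          + (of_nat N)\<^sup>2 * ((x N - x (N - 1)) * cnj (x N - x (N - 1)))"
  proof -
    have "of_real ((real N * norm z)\<^sup>2) = (of_nat N)\<^sup>2 * (z * cnj z)" for z
      unfolding power_mult_distrib of_real_mult sq by simp
    thus ?thesis unfolding sum.lessThan_Suc of_real_add Suc.IH by (rule arg_cong)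
  qed
  also have "\<dots> = \<mu> * (1 - \<mu>) * of_real (\<Sum>n<N. (norm (x n))\<^sup>2) + \<mu> * (1 - \<mu>) * x N * cnj (x N)
          + (of_nat (Suc N))\<^sup>2 * (cnj (x N) * (x (Suc N) - x N))"
    unfolding J by (simp add: algebra_simps)
  also have "\<mu> * (1 - \<mu>) * of_real (\<Sum>n<N. (norm (x n))\<^sup>2) + \<mu> * (1 - \<mu>) * x N * cnj (x N)
      = \<mu> * (1 - \<mu>) * of_real (\<Sum>n<Suc N. (norm (x n))\<^sup>2)"
    unfolding sum.lessThan_Suc of_real_add sq by (simp add: distrib_left mult.assoc)
  finally show ?case by simp
qed simp

text \<open>
  A discrete Caccioppoli estimate: the partial sums are bounded by the real part of \<open>energy_identity\<close>
  whenever the boundary term is not positive.  This happens for arbitrarily large $N$, since otherwise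
  $|x_n|$ would eventually increase strictly and could not tend to $0$.
\<close>

lemma ell2_gradient:
  assumes eig: "jacobi_eigen \<mu> x" and l2: "x \<in> ell2"
  shows "summable (\<lambda>n. (real n * norm (x n - x (n - 1)))\<^sup>2)"
proof -
  have s: "summable (\<lambda>n. (norm (x n))\<^sup>2)" using l2 by (simp add: ell2_def)
  define B where "B = \<bar>Re (\<mu> * (1 - \<mu>))\<bar> * (\<Sum>n. (norm (x n))\<^sup>2)"
  have inward: "\<exists>N\<ge>K. Re (cnj (x (N - 1)) * (x N - x (N - 1))) \<le> 0" for K
  proof (rule ccontr)
    assume "\<not> ?thesis"
    hence pos: "Re (cnj (x (N - 1)) * (x N - x (N - 1))) > 0" if "N \<ge> K" for N
      using that by force
    have inc: "(norm (x n))\<^sup>2 < (norm (x (Suc n)))\<^sup>2" if "n \<ge> K" for n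
    proof -
      have "(norm (x (Suc n)))\<^sup>2 = (norm (x n))\<^sup>2 + 2 * Re (cnj (x n) * (x (Suc n) - x n)) + (norm (x (Suc n) - x n))\<^sup>2"
        unfolding cmod_power2 by (simp add: power2_eq_square algebra_simps)
      thus ?thesis using pos[of "Suc n"] that by (smt (verit) diff_Suc_1 le_Suc_eq zero_le_power2)
    qed
    have mono: "incseq (\<lambda>n. (norm (x (n + K)))\<^sup>2)"
      by (rule incseq_SucI) (use inc in \<open>simp add: less_imp_le\<close>)
    have "(\<lambda>n. (norm (x (n + K)))\<^sup>2) \<longlonglongrightarrow> 0"
      using summable_LIMSEQ_zero[OF s] by (rule LIMSEQ_ignore_initial_segment)
    from incseq_le[OF mono this, of 1] inc[of K] show False
      by (smt (verit) add.commute le_refl plus_1_eq_Suc zero_le_power2)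
  qed
  show ?thesis
  proof (rule summableI_nonneg_bounded)
    fix K
    obtain N where N: "N \<ge> K" "Re (cnj (x (N - 1)) * (x N - x (N - 1))) \<le> 0"
      using inward by blast
    have "(\<Sum>n<K. (real n * norm (x n - x (n - 1)))\<^sup>2) \<le> (\<Sum>n<N. (real n * norm (x n - x (n - 1)))\<^sup>2)"
      using N(1) by (intro sum_mono2) auto
    also have "\<dots> = Re (\<mu> * (1 - \<mu>)) * (\<Sum>n<N. (norm (x n))\<^sup>2)
        + (real N)\<^sup>2 * Re (cnj (x (N - 1)) * (x N - x (N - 1)))"
    proof -
      have "Re (z * of_real r + (of_nat N)\<^sup>2 * w) = Re z * r + (real N)\<^sup>2 * Re w" for z w r
        by (simp flip: of_nat_power)
      thus ?thesis using arg_cong[OF energy_identity[OF eig, of N], of Re] by (simp only: Re_complex_of_real)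
    qed
    also have "\<dots> \<le> \<bar>Re (\<mu> * (1 - \<mu>))\<bar> * (\<Sum>n. (norm (x n))\<^sup>2) + 0"
    proof (intro add_mono mult_mono)
      show "(\<Sum>n<N. (norm (x n))\<^sup>2) \<le> (\<Sum>n. (norm (x n))\<^sup>2)" using s by (intro sum_le_suminf) auto
      show "(real N)\<^sup>2 * Re (cnj (x (N - 1)) * (x N - x (N - 1))) \<le> 0"
        using N(2) by (intro mult_nonneg_nonpos) auto
    qed (auto intro: sum_nonneg)
    finally show "(\<Sum>n<K. (real n * norm (x n - x (n - 1)))\<^sup>2) \<le> B" by (simp add: B_def)
  qed simp
qed

text \<open>
  The imaginary part of \<open>energy_identity\<close> bounds $(n+1)^2\,|x_n|\,|x_{n+1} - x_n|$ below by a positive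
  constant.  So $|x_n|$ and $(n+1)\,|x_{n+1} - x_n|$ have a product of order at least $1/n$ and cannot both
  be square-summable.
\<close>

lemma not_ell2_nonreal_eigenvalue:
  assumes eig: "jacobi_eigen \<mu> x" and im: "Im (\<mu> * (1 - \<mu>)) \<noteq> 0" and x0: "x 0 \<noteq> 0"
  shows "x \<notin> ell2"
proof
  assume l2: "x \<in> ell2"
  define f where "f n = (norm (x n))\<^sup>2 + (real (Suc n) * norm (x (Suc n) - x n))\<^sup>2" for n
  have "summable (\<lambda>n. (real (Suc n) * norm (x (Suc n) - x n))\<^sup>2)"
    using ell2_gradient[OF eig l2] by (subst (asm) summable_Suc_iff[symmetric]) simp
  hence "summable f" unfolding f_def using l2 by (intro summable_add) (auto simp: ell2_def)
  moreover have "\<not> summable f"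
  proof (rule not_summable_if_ge_harmonic)
    let ?c = "2 * (\<bar>Im (\<mu> * (1 - \<mu>))\<bar> * (norm (x 0))\<^sup>2)"
    show "0 < ?c" using im x0 by simp
    show "\<forall>\<^sub>F n in sequentially. ?c / real (Suc n) \<le> f n"
    proof (intro always_eventually allI)
      fix n
      let ?S = "\<Sum>k<Suc n. (norm (x k))\<^sup>2" and ?b = "cnj (x n) * (x (Suc n) - x n)"
      have "Im (z * of_real r + (of_nat (Suc n))\<^sup>2 * w) = Im z * r + (real (Suc n))\<^sup>2 * Im w" for z w r
        by (simp flip: of_nat_power del: of_nat_Suc)
      hence "Im (\<mu> * (1 - \<mu>)) * ?S + (real (Suc n))\<^sup>2 * Im ?b = 0"
        using arg_cong[OF energy_identity[OF eig, of "Suc n"], of Im] by (simp only: Im_complex_of_real diff_Suc_1)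
      hence "Im (\<mu> * (1 - \<mu>)) * ?S = - ((real (Suc n))\<^sup>2 * Im ?b)" by linarith
      hence "\<bar>Im (\<mu> * (1 - \<mu>)) * ?S\<bar> = \<bar>(real (Suc n))\<^sup>2 * Im ?b\<bar>" by linarith
      hence bd: "\<bar>Im (\<mu> * (1 - \<mu>))\<bar> * ?S = (real (Suc n))\<^sup>2 * \<bar>Im ?b\<bar>"
        unfolding abs_mult by (simp only: abs_of_nonneg[OF sum_nonneg] zero_le_power2 abs_of_nonneg)
      have "(norm (x 0))\<^sup>2 \<le> ?S" by (rule member_le_sum) auto
      hence "\<bar>Im (\<mu> * (1 - \<mu>))\<bar> * (norm (x 0))\<^sup>2 \<le> \<bar>Im (\<mu> * (1 - \<mu>))\<bar> * ?S"
        by (intro mult_left_mono) auto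
      also have "\<dots> \<le> (real (Suc n))\<^sup>2 * (norm (x n) * norm (x (Suc n) - x n))"
        unfolding bd using abs_Im_le_cmod[of ?b] by (intro mult_left_mono) (auto simp: norm_mult)
      finally have "?c \<le> 2 * ((real (Suc n))\<^sup>2 * (norm (x n) * norm (x (Suc n) - x n)))"
        by (intro mult_left_mono) auto
      also have "\<dots> = real (Suc n) * (2 * norm (x n) * (real (Suc n) * norm (x (Suc n) - x n)))"
        by (simp only: power2_eq_square mult_ac)
      also have "\<dots> \<le> real (Suc n) * f n"
        unfolding f_def by (intro mult_left_mono sum_squares_bound) auto
      finally show "?c / real (Suc n) \<le> f n" by (simp add: pos_divide_le_eq mult.commute del: of_nat_Suc)
    qed
  qed
  ultimately show False by simp
qed

text \<open>
  Starting from positive values, all terms in \<open>ladder_Suc\<close> and \<open>ladder_factor\<close> stay nonnegative.  Dropping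
  the ladder term from the latter leaves $x_n \ge \frac{n}{n+\mu}\,x_{n-1} \ge \frac{n}{n+1/2}\,x_{n-1}$, which
  makes $(n + \frac12)\,x_n^2$ nondecreasing.
\<close>

lemma not_ell2_real_parameter:
  fixes m :: real
  assumes eig: "jacobi_eigen (of_real m) x" and m: "0 < m" "m \<le> 1 / 2" and x0: "x 0 \<noteq> 0"
  shows "x \<notin> ell2"
proof
  assume l2: "x \<in> ell2"
  \<comment> \<open>Dividing by \<open>x 0\<close> makes the solution real; taking real parts keeps both recurrences, as their
    coefficients are real.\<close>
  define u where "u n = Re (x n / x 0)" for n
  define b where "b n = Re (ladder (of_real m) x n / x 0)" for n
  have Re_scale: "Re (of_real r * z / x 0) = r * Re (z / x 0)" for r z
    unfolding times_divide_eq_right[symmetric] times_complex.sel by simp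
  have xrec: "(real (Suc n) + m) * u (Suc n) = real (Suc n) * u n + b (Suc n)" for n
  proof -
    have "of_real (real (Suc n) + m) * x (Suc n) / x 0
        = of_real (real (Suc n)) * x n / x 0 + ladder (of_real m) x (Suc n) / x 0"
      using ladder_factor[of "Suc n" "of_real m" x] by (simp add: add_divide_distrib)
    from arg_cong[OF this, of Re] show ?thesis
      unfolding plus_complex.sel Re_scale u_def b_def .
  qed
  have brec: "(real (Suc n))\<^sup>2 * b (Suc n) = real n * (real (Suc n) + m) * b n + m ^ 3 * u n" for n
  proof -
    have "of_real ((real (Suc n))\<^sup>2) * ladder (of_real m) x (Suc n) / x 0
        = of_real (real n * (real (Suc n) + m)) * ladder (of_real m) x n / x 0 + of_real (m ^ 3) * x n / x 0"
      using ladder_Suc[OF eig, of n] by (simp add: add_divide_distrib)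
    from arg_cong[OF this, of Re] show ?thesis
      unfolding plus_complex.sel Re_scale u_def b_def .
  qed
  have pos: "0 < u n \<and> 0 \<le> b n" for n
  proof (induction n)
    case 0
    show ?case using x0 m by (simp add: u_def b_def ladder_def)
  next
    case (Suc n)
    hence "0 \<le> real n * (real (Suc n) + m) * b n + m ^ 3 * u n" using m by simp
    hence b: "0 \<le> b (Suc n)" unfolding brec[symmetric] by (simp add: zero_le_mult_iff)
    have "0 < real (Suc n) * u n + b (Suc n)" using Suc b by (intro add_pos_nonneg) auto
    hence "0 < u (Suc n)" unfolding xrec[symmetric] using m by (simp add: zero_less_mult_iff)
    thus ?case using b by simp
  qed
  have lower: "1 / 2 \<le> (real n + 1 / 2) * (u n)\<^sup>2" for n
  proof (induction n)
    case 0
    show ?case using x0 by (simp add: u_def)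
  next
    case (Suc n)
    define N where "N = real (Suc n)"
    have N: "N \<ge> 1" by (simp add: N_def)
    have "N * u n \<le> (N + m) * u (Suc n)" using xrec[of n] pos[of "Suc n"] by (simp add: N_def)
    also have "\<dots> \<le> (N + 1 / 2) * u (Suc n)" using m pos[of "Suc n"] by (intro mult_right_mono) auto
    finally have "(N * u n)\<^sup>2 \<le> ((N + 1 / 2) * u (Suc n))\<^sup>2"
      using N pos[of n] by (intro power_mono) auto
    hence "(N - 1 / 2) * (N\<^sup>2 * (u n)\<^sup>2) \<le> (N - 1 / 2) * ((N + 1 / 2)\<^sup>2 * (u (Suc n))\<^sup>2)"
      using N by (intro mult_left_mono) (auto simp: power_mult_distrib)
    also have "\<dots> = ((N - 1 / 2) * (N + 1 / 2)) * ((N + 1 / 2) * (u (Suc n))\<^sup>2)"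
      by (simp add: power2_eq_square mult_ac)
    also have "\<dots> \<le> N\<^sup>2 * ((N + 1 / 2) * (u (Suc n))\<^sup>2)"
      using N by (intro mult_right_mono) (auto simp: power2_eq_square algebra_simps)
    finally have "N\<^sup>2 * ((N - 1 / 2) * (u n)\<^sup>2) \<le> N\<^sup>2 * ((N + 1 / 2) * (u (Suc n))\<^sup>2)"
      by (simp add: mult_ac)
    hence "(N - 1 / 2) * (u n)\<^sup>2 \<le> (N + 1 / 2) * (u (Suc n))\<^sup>2" using N by simp
    moreover have "N - 1 / 2 = real n + 1 / 2" by (simp add: N_def)
    ultimately have "(real n + 1 / 2) * (u n)\<^sup>2 \<le> (real (Suc n) + 1 / 2) * (u (Suc n))\<^sup>2"
      by (simp only: N_def)
    with Suc show ?case by (rule order_trans)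
  qed
  have "\<not> summable (\<lambda>n. (norm (x n))\<^sup>2)"
  proof (rule not_summable_if_ge_harmonic[of "(norm (x 0))\<^sup>2 / 2"])
    show "\<forall>\<^sub>F n in sequentially. (norm (x 0))\<^sup>2 / 2 / real (Suc n) \<le> (norm (x n))\<^sup>2"
    proof (intro always_eventually allI)
      fix n
      have "1 / 2 \<le> real (Suc n) * (u n)\<^sup>2"
        by (rule order_trans[OF lower[of n]]) (intro mult_right_mono, auto)
      also have "\<dots> \<le> real (Suc n) * (norm (x n / x 0))\<^sup>2"
        using pos[of n] complex_Re_le_cmod[of "x n / x 0"]
        by (intro mult_left_mono power_mono) (auto simp: u_def)
      finally show "(norm (x 0))\<^sup>2 / 2 / real (Suc n) \<le> (norm (x n))\<^sup>2"
        using x0 by (simp add: norm_divide power_divide field_simps)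
    qed
  qed (use x0 in simp)
  thus False using l2 by (simp add: ell2_def)
qed

lemma jacobi_eigen_zero_pair:
  assumes "jacobi_eigen \<mu> x" "x n = 0" "x (n - 1) = 0"
  shows "x 0 = 0"
  using assms(2,3)
proof (induction n)
  case (Suc n)
  hence "x n = 0" by simp
  moreover have "flux x n = 0"
  proof -
    have "flux x (Suc n) = 0" using Suc.prems by (simp add: flux_def)
    moreover have "jacobi x n = 0"
      using assms(1) \<open>x n = 0\<close> unfolding jacobi_eigen_def by simp
    ultimately show ?thesis by (simp add: jacobi_def)
  qed
  hence "n = 0 \<or> x (n - 1) = 0" using \<open>x n = 0\<close> by (simp add: flux_def)
  ultimately show ?case using Suc.IH by auto
qed simp

text \<open>
  Both $\mu$ and $1-\mu$ have real part $1/2$, so in each step the absolute value of either ladder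
  expression is multiplied by at least $1 - \frac1{2n}$, up to $O(n^{-2})$ and an error proportional to $|x_n|/n^2$.  Their difference is
  $(2\mu-1)\,x_n$, so this error is bounded by the sum $S_n$ of their absolute values.  Hence $S_n^2$ is at
  least of order $1/n$.  On the other hand $S_n$ is square-summable by \<open>ell2_gradient\<close> if $x$ is.
\<close>

lemma not_ell2_critical_line:
  assumes eig: "jacobi_eigen \<mu> x" and re: "Re \<mu> = 1 / 2" and im: "Im \<mu> \<noteq> 0" and x0: "x 0 \<noteq> 0"
  shows "x \<notin> ell2"
proof
  assume l2: "x \<in> ell2"
  have eig': "jacobi_eigen (1 - \<mu>) x" using eig by (simp add: jacobi_eigen_def mult.commute)
  define L where "L \<nu> n = norm (ladder \<nu> x n)" for \<nu> n
  define S where "S n = L \<mu> n + L (1 - \<mu>) n" for n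
  define E where "E = norm (2 * \<mu> - 1)"
  define K where "K = norm \<mu> ^ 3 + norm (1 - \<mu>) ^ 3"
  \<comment> \<open>The step factor of \<open>S\<close> is at least \<open>1 - (N + D) / (2 * N\<^sup>2)\<close>; the shift by \<open>D\<close> in \<open>T\<close> below
    absorbs the part of order \<open>1 / N\<^sup>2\<close>.\<close>
  define D where "D = 1 + 2 * (K / E)"
  have E: "E > 0" using im by (auto simp: E_def complex_eq_iff)
  have K: "K \<ge> 0" by (simp add: K_def)
  have D: "D \<ge> 1" using E K by (simp add: D_def)
  have xS: "norm (x n) \<le> S n / E" for n
  proof -
    have "(2 * \<mu> - 1) * x n = ladder \<mu> x n - ladder (1 - \<mu>) x n"
      by (simp add: ladder_def algebra_simps)
    hence "E * norm (x n) \<le> S n"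
      unfolding E_def S_def L_def norm_mult[symmetric] by (simp add: norm_triangle_ineq4)
    thus ?thesis using E by (simp add: pos_le_divide_eq mult.commute)
  qed
  have Lstep: "real n * (real (Suc n) + 1 / 2) * L \<nu> n - norm \<nu> ^ 3 * norm (x n) \<le> (real (Suc n))\<^sup>2 * L \<nu> (Suc n)"
    if "jacobi_eigen \<nu> x" "Re \<nu> = 1 / 2" for \<nu> n
  proof -
    have "real (Suc n) + 1 / 2 \<le> norm (of_nat (Suc n) + \<nu>)"
      using complex_Re_le_cmod[of "of_nat (Suc n) + \<nu>"] that(2) by simp
    hence "real n * (real (Suc n) + 1 / 2) * L \<nu> n \<le> real n * norm (of_nat (Suc n) + \<nu>) * L \<nu> n"
      by (intro mult_right_mono mult_left_mono) (auto simp: L_def)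
    also have "\<dots> = norm (of_nat n * (of_nat (Suc n) + \<nu>) * ladder \<nu> x n)"
      by (simp add: norm_mult L_def)
    also have "\<dots> = norm ((of_nat (Suc n))\<^sup>2 * ladder \<nu> x (Suc n) - \<nu> ^ 3 * x n)"
      unfolding ladder_Suc[OF that(1)] by simp
    also have "\<dots> \<le> norm ((of_nat (Suc n))\<^sup>2 * ladder \<nu> x (Suc n)) + norm (\<nu> ^ 3 * x n)"
      by (rule norm_triangle_ineq4)
    also have "\<dots> = (real (Suc n))\<^sup>2 * L \<nu> (Suc n) + norm \<nu> ^ 3 * norm (x n)"
      by (simp add: norm_mult norm_power L_def del: of_nat_Suc)
    finally show ?thesis by simp
  qed
  define T where "T n = (real n - D) * (S n)\<^sup>2" for n
  have Tmono: "T n \<le> T (Suc n)" if "D \<le> real (Suc n)" for n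
  proof -
    define N where "N = real (Suc n)"
    have N: "N \<ge> 1" "N \<ge> D" "real n = N - 1" using that by (auto simp: N_def)
    have Snn: "S n \<ge> 0" by (simp add: S_def L_def)
    have "K * norm (x n) \<le> K * (S n / E)" using xS K by (intro mult_left_mono)
    moreover have "(N - 1) * (N + 1 / 2) * S n - K * norm (x n) \<le> N\<^sup>2 * S (Suc n)"
      using Lstep[OF eig re, of n] Lstep[OF eig', of n] re
      unfolding S_def K_def N_def[symmetric] N(3) by (simp add: algebra_simps)
    moreover have "(N\<^sup>2 - (N + D) / 2) * S n = (N - 1) * (N + 1 / 2) * S n - K * (S n / E)"
      by (simp add: D_def power2_eq_square field_simps)
    ultimately have "(N\<^sup>2 - (N + D) / 2) * S n \<le> N\<^sup>2 * S (Suc n)" by linarith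
    hence q: "(1 - (N + D) / (2 * N\<^sup>2)) * S n \<le> S (Suc n)"
      using N by (simp add: field_simps)
    have "N + D \<le> 2 * N\<^sup>2"
    proof -
      have "N * 1 \<le> N * N" using N by (intro mult_left_mono) auto
      thus ?thesis using N unfolding power2_eq_square by linarith
    qed
    hence nn: "0 \<le> 1 - (N + D) / (2 * N\<^sup>2)" using N by (simp add: field_simps)
    have "(1 - (N + D) / N\<^sup>2) * (S n)\<^sup>2 \<le> (1 - (N + D) / (2 * N\<^sup>2))\<^sup>2 * (S n)\<^sup>2"
    proof (rule mult_right_mono)
      have "1 - 2 * y \<le> (1 - y)\<^sup>2" for y :: real by (simp add: power2_eq_square algebra_simps)
      moreover have "2 * ((N + D) / (2 * N\<^sup>2)) = (N + D) / N\<^sup>2" using N by (simp add: field_simps)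
      ultimately show "1 - (N + D) / N\<^sup>2 \<le> (1 - (N + D) / (2 * N\<^sup>2))\<^sup>2" by metis
    qed simp
    also have "\<dots> \<le> (S (Suc n))\<^sup>2"
      using power_mono[OF q, of 2] nn Snn by (simp add: power_mult_distrib)
    finally have sq: "(1 - (N + D) / N\<^sup>2) * (S n)\<^sup>2 \<le> (S (Suc n))\<^sup>2" .
    have "(N - 1 - D) * N\<^sup>2 \<le> (N - D) * (N\<^sup>2 - (N + D))"
      using D by (simp add: algebra_simps power2_eq_square)
    hence "N - 1 - D \<le> (N - D) * (1 - (N + D) / N\<^sup>2)" using N by (simp add: field_simps)
    hence "T n \<le> (N - D) * (1 - (N + D) / N\<^sup>2) * (S n)\<^sup>2"
      unfolding T_def N(3) by (intro mult_right_mono) auto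
    also have "\<dots> \<le> (N - D) * (S (Suc n))\<^sup>2"
      using mult_left_mono[OF sq, of "N - D"] N by (simp add: mult.assoc)
    finally show ?thesis by (simp add: T_def N_def)
  qed
  obtain k where k: "D < real k" using reals_Archimedean2 by blast
  have k0: "k > 0" using k D by (cases k) auto
  have "S k > 0"
  proof (rule ccontr)
    assume "\<not> S k > 0"
    hence "norm (ladder \<mu> x k) + norm (ladder (1 - \<mu>) x k) \<le> 0" by (simp add: S_def L_def)
    hence L0: "ladder \<mu> x k = 0" "ladder (1 - \<mu>) x k = 0"
      by (smt (verit) norm_ge_zero norm_le_zero_iff)+
    hence "S k = 0" by (simp add: S_def L_def)
    hence "x k = 0" using xS[of k] by simp
    moreover from this L0(1) k0 have "x (k - 1) = 0" by (simp add: ladder_def)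
    ultimately show False using jacobi_eigen_zero_pair[OF eig] x0 by blast
  qed
  hence Tk: "T k > 0" using k by (simp add: T_def)
  have Tge: "T k \<le> T n" if "n \<ge> k" for n
    using that
  proof (induction n rule: dec_induct)
    case (step n)
    have "D \<le> real (Suc n)" using k step.hyps by simp
    thus ?case using Tmono[of n] step.IH by simp
  qed simp
  have "\<not> summable (\<lambda>n. (S n)\<^sup>2)"
  proof (rule not_summable_if_ge_harmonic[OF Tk], rule eventually_sequentiallyI[of k])
    fix n assume "k \<le> n"
    hence "T k \<le> (real n - D) * (S n)\<^sup>2" using Tge by (simp add: T_def)
    also have "\<dots> \<le> real (Suc n) * (S n)\<^sup>2" using D by (intro mult_right_mono) auto
    finally show "T k / real (Suc n) \<le> (S n)\<^sup>2" by (simp add: pos_divide_le_eq mult.commute del: of_nat_Suc)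
  qed
  moreover have "summable (\<lambda>n. (S n)\<^sup>2)"
  proof (rule summable_comparison_test'[of _ 0])
    let ?g = "\<lambda>n. real n * norm (x n - x (n - 1))" and ?c = "norm \<mu> + norm (1 - \<mu>)"
    show "summable (\<lambda>n. 8 * (?g n)\<^sup>2 + 2 * ?c\<^sup>2 * (norm (x n))\<^sup>2)"
      using l2 ell2_gradient[OF eig l2] by (intro summable_add summable_mult) (auto simp: ell2_def)
    fix n
    have "L \<nu> n \<le> ?g n + norm \<nu> * norm (x n)" for \<nu>
      unfolding L_def ladder_def by (rule order_trans[OF norm_triangle_ineq]) (simp add: norm_mult)
    from add_mono[OF this[of \<mu>] this[of "1 - \<mu>"]]
    have "S n \<le> 2 * ?g n + ?c * norm (x n)" by (simp add: S_def algebra_simps)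
    hence "(S n)\<^sup>2 \<le> (2 * ?g n + ?c * norm (x n))\<^sup>2" by (intro power_mono) (auto simp: S_def L_def)
    also have "(a + b)\<^sup>2 \<le> 2 * a\<^sup>2 + 2 * b\<^sup>2" for a b :: real
      using sum_squares_bound[of a b] by (simp add: power2_eq_square algebra_simps)
    hence "(2 * ?g n + ?c * norm (x n))\<^sup>2 \<le> 2 * (2 * ?g n)\<^sup>2 + 2 * (?c * norm (x n))\<^sup>2" .
    also have "\<dots> = 8 * (?g n)\<^sup>2 + 2 * ?c\<^sup>2 * (norm (x n))\<^sup>2" by (simp add: power_mult_distrib)
    finally show "norm ((S n)\<^sup>2) \<le> 8 * (?g n)\<^sup>2 + 2 * ?c\<^sup>2 * (norm (x n))\<^sup>2" by simp
  qed
  ultimately show False by simp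
qed

text \<open>
  Since $\Im(\mu(1-\mu)) = \Im\mu\,(1 - 2\Re\mu)$, the eigenvalue fails to be real unless $\mu$ is real or
  $\Re\mu = 1/2$, so the three preceding cases are exhaustive.
\<close>

lemma jacobi_eigen_not_ell2:
  assumes eig: "jacobi_eigen \<mu> x" and re: "0 < Re \<mu>" "Re \<mu> \<le> 1 / 2" and x0: "x 0 \<noteq> 0"
  shows "x \<notin> ell2"
proof (cases "Im \<mu> = 0")
  case True
  hence "\<mu> = of_real (Re \<mu>)" by (simp add: complex_eq_iff)
  thus ?thesis using not_ell2_real_parameter[of "Re \<mu>" x] eig re x0 by simp
next
  case False
  show ?thesis
  proof (cases "Re \<mu> = 1 / 2")
    case True
    thus ?thesis using not_ell2_critical_line[OF eig] False x0 by blast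
  next
    case nc: False
    have "Im (\<mu> * (1 - \<mu>)) = Im \<mu> * (1 - 2 * Re \<mu>)" by (simp add: algebra_simps)
    hence "Im (\<mu> * (1 - \<mu>)) \<noteq> 0" using False nc by simp
    thus ?thesis using not_ell2_nonreal_eigenvalue[OF eig] x0 by blast
  qed
qed

theorem theorem1:
  fixes \<mu> :: complex
  assumes "0 < Re \<mu>" and "Re \<mu> \<le> 1 / 2"
  shows "hilbert_seq \<mu> \<in> hilbert_domain
       \<and> hilbert_apply (hilbert_seq \<mu>)
           = (\<lambda>n. of_real pi / sin (of_real pi * \<mu>) * hilbert_seq \<mu> n)
       \<and> hilbert_seq \<mu> \<notin> ell2"
proof -
  have lt1: "Re \<mu> < 1" using assms(2) by simp
  note eig = hilbert_seq_eigen[OF assms(1) lt1]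
  have "hilbert_seq \<mu> 0 = gamma_coeff \<mu> 0" by (simp add: hilbert_seq_def gamma_coeff_def)
  hence x0: "hilbert_seq \<mu> 0 \<noteq> 0" using gamma_coeff_nonzero[OF assms(1) lt1] by simp
  show ?thesis
    using hilbert_apply_eigen(1)[OF eig assms] hilbert_apply_eq[OF eig assms x0]
      jacobi_eigen_not_ell2[OF eig assms x0] by auto
qed

end
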